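(* Let $F$ be a simple graph of order $n\ge1$ and let $V_k=\{v_1,\ldots,v_k\}\subseteq V(F)$ with $|V_k|=k$. Let $H_u$ and $H_v$ be two disjoint simple graphs of order $m$ with specified vertices $u$ of $H_u$ and $v$ of $H_v$, each of degree $m-1$ in its graph, such that $H_u-u$ and $H_v-v$ are $r_1$-regular, where $m\ge2$ and $r_1\ge1$. If $H_u$ and $H_v$ are $Q$-cospectral, then $G[F,V_k,H_u]$ and $G[F,V_k,H_v]$ are $Q$-cospectral.
   Context: All graphs are finite and simple. $Q(X)=D(X)+A(X)$ is the signless Laplacian matrix of a graph $X$ ($D$ the diagonal degree matrix, $A$ the adjacency matrix). Two graphs are $Q$-cospectral if their signless Laplacian matrices have the same spectrum (with multiplicities). Graph with $k$ pockets: for a graph $H_w$ with specified vertex $w$, $G[F,V_k,H_w]$ is obtained by taking one copy of $F$ and $k$ vertex-disjoint copies of $H_w$, and, for each $i=1,\ldots,k$, identifying the vertex $w$ of the $i$th copy of $H_w$ with the vertex $v_i$ of $F$. *)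

theory Defs
  imports "Graph_Theory.Pair_Digraph" "Jordan_Normal_Form.Char_Poly"
begin

text \<open>
  A finite simple graph is a \<^locale>\<open>pair_graph\<close>: its vertex set is finite and its arc relation is
  symmetric and irreflexive, an undirected edge being represented by the two opposite arcs.
  Hence the degree of a vertex is its \<^const>\<open>out_degree\<close>.
\<close>

definition regular :: "nat \<Rightarrow> ('a, 'b) pre_digraph \<Rightarrow> bool" where
  "regular r X \<longleftrightarrow> (\<forall>x\<in>verts X. out_degree X x = r)"


subsection \<open>The signless Laplacian matrix\<close>

text \<open>Matrices of a graph are taken with respect to an enumeration \<open>xs\<close> of its vertex set.\<close>

definition degree_matrix :: "'a pair_pre_digraph \<Rightarrow> 'a list \<Rightarrow> real mat" where
  "degree_matrix X xs = mat (length xs) (length xs)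
     (\<lambda>(i, j). if i = j then real (out_degree (with_proj X) (xs ! i)) else 0)"

definition adjacency_matrix :: "'a pair_pre_digraph \<Rightarrow> 'a list \<Rightarrow> real mat" where
  "adjacency_matrix X xs = mat (length xs) (length xs)
     (\<lambda>(i, j). if (xs ! i, xs ! j) \<in> parcs X then 1 else 0)"

definition signless_laplacian :: "'a pair_pre_digraph \<Rightarrow> 'a list \<Rightarrow> real mat" where
  "signless_laplacian X xs = degree_matrix X xs + adjacency_matrix X xs"

definition vertex_list :: "'a pair_pre_digraph \<Rightarrow> 'a list" where
  "vertex_list X = (SOME xs. distinct xs \<and> set xs = pverts X)"

text \<open>
  The multiset of all complex eigenvalues, with their algebraic multiplicities. By
  \<open>char_poly_signless_laplacian_enum\<close> below, it does not depend on the chosen enumeration.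
\<close>

definition Q_spectrum :: "'a pair_pre_digraph \<Rightarrow> complex multiset" where
  "Q_spectrum X =
     proots (char_poly (map_mat complex_of_real (signless_laplacian X (vertex_list X))))"

definition Q_cospectral :: "'a pair_pre_digraph \<Rightarrow> 'b pair_pre_digraph \<Rightarrow> bool" where
  "Q_cospectral X Y \<longleftrightarrow> Q_spectrum X = Q_spectrum Y"

lemma vertex_list:
  assumes "finite (pverts X)"
  shows "distinct (vertex_list X)" "set (vertex_list X) = pverts X"
proof -
  have "\<exists>xs. distinct xs \<and> set xs = pverts X"
    using finite_distinct_list[OF assms] by blast
  then have "distinct (vertex_list X) \<and> set (vertex_list X) = pverts X"
    unfolding vertex_list_def by (rule someI_ex)
  then show "distinct (vertex_list X)" "set (vertex_list X) = pverts X" by auto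
qed

lemma char_poly_signless_laplacian_enum:
  assumes xs: "distinct xs" "set xs = pverts X" and ys: "distinct ys" "set ys = pverts X"
  shows "char_poly (map_mat complex_of_real (signless_laplacian X xs)) =
    char_poly (map_mat complex_of_real (signless_laplacian X ys))"
proof -
  define n where "n = length xs"
  have n: "length xs = n" "length ys = n"
    using xs ys distinct_card[of xs] distinct_card[of ys] by (auto simp: n_def)
  define f where "f a b = complex_of_real
    ((if a = b then real (out_degree (with_proj X) a) else 0) + (if (a, b) \<in> parcs X then 1 else 0))"
    for a b
  define P where "P us vs = mat n n (\<lambda>(i, j). if us ! i = vs ! j then 1 else (0::complex))"
    for us vs :: "'a list"
  have L: "map_mat complex_of_real (signless_laplacian X zs) = mat n n (\<lambda>(i, j). f (zs ! i) (zs ! j))"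
    if "distinct zs" "length zs = n" for zs
    using that
    by (intro eq_matI) (auto simp: signless_laplacian_def degree_matrix_def adjacency_matrix_def
        f_def nth_eq_iff_index_eq)
  have ex1: "\<exists>j<n. vs ! j = us ! i" if "set us = set vs" "length us = n" "length vs = n" "i < n"
    for i and us vs :: "'a list"
    using that by (metis in_set_conv_nth)
  have sum_l: "(\<Sum>j = 0..<n. (if us ! i = vs ! j then 1 else 0) * g (vs ! j)) = g (us ! i)"
    if "distinct vs" "set us = set vs" "length us = n" "length vs = n" "i < n"
    for i and us vs :: "'a list" and g :: "'a \<Rightarrow> complex"
  proof -
    from ex1[OF that(2-5)] obtain k where k: "k < n" "vs ! k = us ! i" by blast
    have "(\<Sum>j = 0..<n. (if us ! i = vs ! j then 1 else 0) * g (vs ! j)) =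
        (\<Sum>j = 0..<n. if j = k then g (us ! i) else 0)"
      using that k by (intro sum.cong) (auto simp: nth_eq_iff_index_eq)
    then show ?thesis using k by simp
  qed
  have P_P: "P us vs * P vs us = 1\<^sub>m n"
    if "distinct us" "distinct vs" "set us = set vs" "length us = n" "length vs = n" for us vs
  proof (rule eq_matI)
    fix i j assume ij: "i < dim_row (1\<^sub>m n :: complex mat)" "j < dim_col (1\<^sub>m n :: complex mat)"
    then have "(P us vs * P vs us) $$ (i, j) =
        (\<Sum>l = 0..<n. (if us ! i = vs ! l then 1 else 0) * (if vs ! l = us ! j then 1 else 0))"
      by (simp add: P_def scalar_prod_def)
    also have "\<dots> = (if us ! i = us ! j then 1 else 0)"
      using sum_l[of vs us i "\<lambda>a. if a = us ! j then 1 else 0"] that ij by simp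
    finally show "(P us vs * P vs us) $$ (i, j) = 1\<^sub>m n $$ (i, j)"
      using that ij by (simp add: nth_eq_iff_index_eq)
  qed (auto simp: P_def)
  let ?A = "mat n n (\<lambda>(i, j). f (xs ! i) (xs ! j))"
  let ?B = "mat n n (\<lambda>(i, j). f (ys ! i) (ys ! j))"
  have PB: "P xs ys * ?B = mat n n (\<lambda>(i, j). f (xs ! i) (ys ! j))"
  proof (rule eq_matI)
    fix i j assume "i < dim_row (mat n n (\<lambda>(i, j). f (xs ! i) (ys ! j)))"
      "j < dim_col (mat n n (\<lambda>(i, j). f (xs ! i) (ys ! j)))"
    then show "(P xs ys * ?B) $$ (i, j) = mat n n (\<lambda>(i, j). f (xs ! i) (ys ! j)) $$ (i, j)"
      using sum_l[of ys xs i "\<lambda>a. f a (ys ! j)"] xs ys n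
      by (simp add: P_def scalar_prod_def)
  qed (auto simp: P_def)
  have "P xs ys * ?B * P ys xs = ?A"
  proof (rule eq_matI)
    fix i j assume ij: "i < dim_row ?A" "j < dim_col ?A"
    then have "(P xs ys * ?B * P ys xs) $$ (i, j) =
        (\<Sum>l = 0..<n. f (xs ! i) (ys ! l) * (if ys ! l = xs ! j then 1 else 0))"
      unfolding PB by (simp add: P_def scalar_prod_def)
    also have "\<dots> = (\<Sum>l = 0..<n. (if xs ! j = ys ! l then 1 else 0) * f (xs ! i) (ys ! l))"
      by (intro sum.cong) auto
    also have "\<dots> = f (xs ! i) (xs ! j)"
      using sum_l[of ys xs j "f (xs ! i)"] xs ys n ij by simp
    finally show "(P xs ys * ?B * P ys xs) $$ (i, j) = ?A $$ (i, j)" using ij by simp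
  qed (auto simp: P_def)
  then have "similar_mat_wit ?A ?B (P xs ys) (P ys xs)"
    using P_P[of xs ys] P_P[of ys xs] xs ys n
    by (auto simp: similar_mat_wit_def Let_def P_def)
  then have "similar_mat ?A ?B" unfolding similar_mat_def by blast
  then show ?thesis using char_poly_similar L xs ys n by metis
qed


subsection \<open>Graphs with pockets\<close>

text \<open>
  The copy of \<open>H\<close> attached at \<open>v \<in> V\<close> has the vertices \<open>Inr (v, y)\<close>, and the vertices of \<open>F\<close>
  are tagged by \<open>Inl\<close>. The quotient map \<open>pocket_glue w\<close> identifies the vertex \<open>w\<close> of that copy
  with the vertex \<open>v\<close> of \<open>F\<close>.
\<close>

definition pocket_glue :: "'b \<Rightarrow> 'a + 'a \<times> 'b \<Rightarrow> 'a + 'a \<times> 'b" where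
  "pocket_glue w z =
     (case z of Inl x \<Rightarrow> Inl x | Inr (v, y) \<Rightarrow> if y = w then Inl v else Inr (v, y))"

definition pocket_graph ::
  "'a pair_pre_digraph \<Rightarrow> 'a set \<Rightarrow> 'b pair_pre_digraph \<Rightarrow> 'b \<Rightarrow> ('a + 'a \<times> 'b) pair_pre_digraph"
where
  "pocket_graph F V H w =
     \<lparr> pverts = pocket_glue w ` (Inl ` pverts F \<union> Inr ` (V \<times> pverts H)),
       parcs = map_prod (pocket_glue w) (pocket_glue w) `
         ({(Inl x, Inl y) | x y. (x, y) \<in> parcs F} \<union>
          {(Inr (v, x), Inr (v, y)) | v x y. v \<in> V \<and> (x, y) \<in> parcs H}) \<rparr>"

lemma pocket_glue_simps [simp]:
  "pocket_glue w (Inl x) = Inl x"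
  "pocket_glue w (Inr (v, y)) = (if y = w then Inl v else Inr (v, y))"
  by (simp_all add: pocket_glue_def)

lemma pair_graph_pocket_graph:
  assumes F: "pair_graph F" and H: "pair_graph H" and V: "V \<subseteq> pverts F"
  shows "pair_graph (pocket_graph F V H w)"
proof -
  interpret F: pair_graph F by fact
  interpret H: pair_graph H by fact
  let ?G = "pocket_graph F V H w"
  have fin: "finite (pverts ?G)"
    using finite_subset[OF V F.pair_finite_verts] F.pair_finite_verts H.pair_finite_verts
    by (simp add: pocket_graph_def)
  have wf: "fst e \<in> pverts ?G \<and> snd e \<in> pverts ?G" if "e \<in> parcs ?G" for e
  proof -
    have verts: "pocket_glue w z \<in> pverts ?G"
      if "z \<in> Inl ` pverts F \<union> Inr ` (V \<times> pverts H)" for z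
      using that unfolding pocket_graph_def by auto
    from \<open>e \<in> parcs ?G\<close> consider x y where "(x, y) \<in> parcs F"
        "e = (pocket_glue w (Inl x), pocket_glue w (Inl y))"
      | v x y where "v \<in> V" "(x, y) \<in> parcs H"
          "e = (pocket_glue w (Inr (v, x)), pocket_glue w (Inr (v, y)))"
      by (auto simp: pocket_graph_def simp del: pocket_glue_simps)
    then show ?thesis
    proof cases
      case 1
      then show ?thesis using F.wellformed[OF 1(1)] by (auto intro!: verts simp del: pocket_glue_simps)
    next
      case 2
      then show ?thesis using H.wellformed[OF 2(2)] by (auto intro!: verts simp del: pocket_glue_simps)
    qed
  qed
  have "finite (parcs ?G)"
    by (rule finite_subset[of _ "pverts ?G \<times> pverts ?G"]) (use wf fin in \<open>auto simp: mem_Times_iff\<close>)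
  moreover have "fst e \<noteq> snd e" if "e \<in> parcs ?G" for e
    using that F.no_loops H.no_loops by (auto simp: pocket_graph_def split: if_splits)
  moreover have "sym (parcs ?G)"
  proof (rule symI)
    have sF: "(y, x) \<in> parcs F" if "(x, y) \<in> parcs F" for x y
      using that F.pair_sym_arcs by (auto simp: symmetric_def dest: symD)
    have sH: "(y, x) \<in> parcs H" if "(x, y) \<in> parcs H" for x y
      using that H.pair_sym_arcs by (auto simp: symmetric_def dest: symD)
    fix a b assume "(a, b) \<in> parcs ?G"
    then consider x y where "(x, y) \<in> parcs F" "a = Inl x" "b = Inl y"
      | v x y where "v \<in> V" "(x, y) \<in> parcs H"
          "a = pocket_glue w (Inr (v, x))" "b = pocket_glue w (Inr (v, y))"
      by (auto simp: pocket_graph_def simp del: pocket_glue_simps(2))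
    then show "(b, a) \<in> parcs ?G"
    proof cases
      case 1
      then show ?thesis using sF[OF 1(1)]
        by (auto simp: pocket_graph_def intro!: image_eqI[where x = "(Inl y, Inl x)"])
    next
      case 2
      then show ?thesis using sH[OF 2(2)]
        unfolding pocket_graph_def
        by (auto simp del: pocket_glue_simps(2)
            intro!: image_eqI[where x = "(Inr (v, y), Inr (v, x))"])
    qed
  qed
  ultimately show ?thesis
    using fin wf by unfold_locales (auto simp: symmetric_def)
qed

end

theory Submission
  imports Defs
begin

text \<open>
  Order the vertices of the pocket graph with those of \<open>F\<close> first. In \<open>x I - Q\<close> the block
  of the remaining vertices is block diagonal, with one copy of \<open>x I - B\<close> per pocket, where \<open>B\<close> is
  the principal submatrix of \<open>Q(H)\<close> on \<open>H - w\<close>. As \<open>B\<close> has constant row sums \<open>2 r + 1\<close> and \<open>w\<close>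
  is adjacent to all of \<open>H - w\<close>, eliminating the pockets changes the block of \<open>F\<close> by a matrix
  depending only on \<open>m\<close> and \<open>r\<close>. Hence the characteristic polynomial of the pocket graph depends on
  \<open>H\<close> only through \<open>m\<close>, \<open>r\<close> and \<open>det (x I - B)\<close>. The case of a single vertex \<open>F\<close> shows that
  \<open>det (x I - B)\<close> is determined by the characteristic polynomial of \<open>Q(H)\<close>.
\<close>

subsection \<open>Matrices indexed by lists\<close>

text \<open>Indexing by vertices instead of numbers makes a block decomposition of the matrix an
  append of vertex lists, and matrix products become sums over vertex sets.\<close>

definition list_mat :: "('a \<Rightarrow> 'b \<Rightarrow> 'c) \<Rightarrow> 'a list \<Rightarrow> 'b list \<Rightarrow> 'c mat" where
  "list_mat q xs ys = mat (length xs) (length ys) (\<lambda>(i, j). q (xs ! i) (ys ! j))"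

lemma list_mat_carrier [simp]: "list_mat q xs ys \<in> carrier_mat (length xs) (length ys)"
  by (simp add: list_mat_def)

lemma list_mat_cong:
  assumes "\<And>x y. x \<in> set xs \<Longrightarrow> y \<in> set ys \<Longrightarrow> q x y = q' x y"
  shows "list_mat q xs ys = list_mat q' xs ys"
  using assms by (intro eq_matI) (auto simp: list_mat_def)

lemma list_mat_map: "list_mat q (map f xs) (map g ys) = list_mat (\<lambda>x y. q (f x) (g y)) xs ys"
  by (intro eq_matI) (auto simp: list_mat_def)

lemma list_mat_zero:
  assumes "\<And>x y. x \<in> set xs \<Longrightarrow> y \<in> set ys \<Longrightarrow> q x y = 0"
  shows "list_mat q xs ys = 0\<^sub>m (length xs) (length ys)"
  using assms by (intro eq_matI) (auto simp: list_mat_def)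

lemma list_mat_append:
  "list_mat q (xs @ ys) (xs' @ ys') =
    four_block_mat (list_mat q xs xs') (list_mat q xs ys') (list_mat q ys xs') (list_mat q ys ys')"
  by (intro eq_matI) (auto simp: list_mat_def nth_append four_block_mat_def Let_def)

lemma det_list_mat_single: "det (list_mat q [x] [x]) = q x x"
  by (subst det_single) (simp_all add: list_mat_def)

lemma list_mat_mult:
  fixes q :: "'a \<Rightarrow> 'b \<Rightarrow> 'd::comm_semiring_0"
  assumes "distinct ys"
  shows "list_mat q xs ys * list_mat q' ys zs = list_mat (\<lambda>x z. \<Sum>y\<in>set ys. q x y * q' y z) xs zs"
proof (rule eq_matI)
  fix i j assume ij: "i < dim_row (list_mat (\<lambda>x z. \<Sum>y\<in>set ys. q x y * q' y z) xs zs)"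
    "j < dim_col (list_mat (\<lambda>x z. \<Sum>y\<in>set ys. q x y * q' y z) xs zs)"
  have "(list_mat q xs ys * list_mat q' ys zs) $$ (i, j) =
      (\<Sum>l = 0..<length ys. q (xs ! i) (ys ! l) * q' (ys ! l) (zs ! j))"
    using ij by (simp add: list_mat_def scalar_prod_def)
  also have "\<dots> = (\<Sum>y\<leftarrow>ys. q (xs ! i) y * q' y (zs ! j))"
    by (simp add: sum_list_sum_nth)
  also have "\<dots> = (\<Sum>y\<in>set ys. q (xs ! i) y * q' y (zs ! j))"
    using assms by (rule sum_list_distinct_conv_sum_set)
  finally show "(list_mat q xs ys * list_mat q' ys zs) $$ (i, j) =
      list_mat (\<lambda>x z. \<Sum>y\<in>set ys. q x y * q' y z) xs zs $$ (i, j)"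
    using ij by (simp add: list_mat_def)
qed (auto simp: list_mat_def)

text \<open>Distinct sublists do not interact, so the matrix is block diagonal; induction splits off
  the first block. Each sublist will be the vertex list of one pocket.\<close>

lemma det_list_mat_concat:
  fixes q :: "'a \<Rightarrow> 'a \<Rightarrow> 'd::idom"
  assumes "distinct vs"
    and "\<And>v v' x y. v \<in> set vs \<Longrightarrow> v' \<in> set vs \<Longrightarrow> v \<noteq> v' \<Longrightarrow> x \<in> set (f v) \<Longrightarrow> y \<in> set (f v') \<Longrightarrow>
      q x y = 0"
  shows "det (list_mat q (concat (map f vs)) (concat (map f vs))) =
    (\<Prod>v\<leftarrow>vs. det (list_mat q (f v) (f v)))"
  using assms
proof (induction vs)
  case Nil
  show ?case by (simp add: list_mat_def)
next
  case (Cons v vs)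
  let ?c = "concat (map f vs)"
  have "list_mat q ?c (f v) = 0\<^sub>m (length ?c) (length (f v))"
    by (rule list_mat_zero) (use Cons.prems in auto)
  then have "det (list_mat q (f v @ ?c) (f v @ ?c)) =
      det (list_mat q (f v) (f v)) * det (list_mat q ?c ?c)"
    unfolding list_mat_append
    by (intro det_four_block_mat_lower_left_zero[of _ "length (f v)" _ "length ?c"])
      (simp_all add: list_mat_def)
  moreover have "det (list_mat q ?c ?c) = (\<Prod>v\<leftarrow>vs. det (list_mat q (f v) (f v)))"
    by (rule Cons.IH) (use Cons.prems in auto)
  ultimately show ?case by simp
qed

text \<open>A Schur complement without division: the lower left block consists of eigenvectors of the
  lower right one.\<close>

lemma det_four_block_mat_eigen:
  fixes s :: "'d::idom"
  assumes A: "A \<in> carrier_mat n n" and B: "B \<in> carrier_mat n p"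
    and C: "C \<in> carrier_mat p n" and D: "D \<in> carrier_mat p p"
    and DC: "D * C = s \<cdot>\<^sub>m C"
  shows "s ^ n * det (four_block_mat A B C D) = det (s \<cdot>\<^sub>m A - B * C) * det D"
proof -
  let ?M = "four_block_mat A B C D"
  \<comment> \<open>Column operations that clear the lower left block: \<open>D * C = s C\<close>
    gives \<open>C * (s I) + D * (- C) = 0\<close>. The block \<open>s I\<close> instead of
    \<open>I\<close> avoids dividing by \<open>s\<close> and costs the factor
    \<open>s ^ n\<close>.\<close>
  let ?T = "four_block_mat (s \<cdot>\<^sub>m 1\<^sub>m n) (0\<^sub>m n p) (- C) (1\<^sub>m p)"
  have "?M * ?T = four_block_mat (A * (s \<cdot>\<^sub>m 1\<^sub>m n) + B * (- C)) (A * 0\<^sub>m n p + B * 1\<^sub>m p)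
      (C * (s \<cdot>\<^sub>m 1\<^sub>m n) + D * (- C)) (C * 0\<^sub>m n p + D * 1\<^sub>m p)"
    by (rule mult_four_block_mat[OF A B C D]) (use C in auto)
  also have "A * (s \<cdot>\<^sub>m 1\<^sub>m n) + B * (- C) = s \<cdot>\<^sub>m A - B * C"
    using A B C by (intro eq_matI) (auto simp: mult_smult_distrib[OF A])
  also have "C * (s \<cdot>\<^sub>m 1\<^sub>m n) + D * (- C) = 0\<^sub>m p n"
  proof -
    have "D * (- C) = - (s \<cdot>\<^sub>m C)" using C D by (simp flip: DC)
    then show ?thesis using C by (intro eq_matI) (auto simp: mult_smult_distrib[OF C])
  qed
  also have "A * 0\<^sub>m n p + B * 1\<^sub>m p = B" using A B by simp
  also have "C * 0\<^sub>m n p + D * 1\<^sub>m p = D" using C D by simp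
  finally have "det (?M * ?T) = det (s \<cdot>\<^sub>m A - B * C) * det D"
    using A B C D
    by (simp add: det_four_block_mat_lower_left_zero[of _ n _ p] minus_carrier_mat)
  moreover have "det (?M * ?T) = det ?M * det ?T"
    using A B C D by (intro det_mult[of _ "n + p"]) auto
  moreover have "det ?T = s ^ n"
    using C by (simp add: det_four_block_mat_upper_right_zero[of _ n _ p])
  ultimately show ?thesis by (simp add: mult.commute)
qed

text \<open>The second assumption is the eigenvector condition \<open>D * C = s C\<close> of the
  previous lemma, read off entry by entry.\<close>

lemma det_list_mat_append_eigen:
  fixes q :: "'a \<Rightarrow> 'a \<Rightarrow> 'd::idom"
  assumes "distinct ys"
    and "\<And>x y. x \<in> set xs \<Longrightarrow> y \<in> set ys \<Longrightarrow> (\<Sum>z\<in>set ys. q y z * q z x) = s * q y x"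
  shows "s ^ length xs * det (list_mat q (xs @ ys) (xs @ ys)) =
    det (list_mat (\<lambda>x x'. s * q x x' - (\<Sum>z\<in>set ys. q x z * q z x')) xs xs) *
    det (list_mat q ys ys)"
proof -
  have "list_mat q ys ys * list_mat q ys xs = list_mat (\<lambda>y x. s * q y x) ys xs"
    unfolding list_mat_mult[OF assms(1)] by (rule list_mat_cong) (use assms(2) in auto)
  also have "\<dots> = s \<cdot>\<^sub>m list_mat q ys xs" by (intro eq_matI) (auto simp: list_mat_def)
  finally have "s ^ length xs * det (list_mat q (xs @ ys) (xs @ ys)) =
      det (s \<cdot>\<^sub>m list_mat q xs xs - list_mat q xs ys * list_mat q ys xs) * det (list_mat q ys ys)"
    unfolding list_mat_append by (intro det_four_block_mat_eigen[of _ _ _ "length ys"]) auto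
  also have "s \<cdot>\<^sub>m list_mat q xs xs - list_mat q xs ys * list_mat q ys xs =
      list_mat (\<lambda>x x'. s * q x x' - (\<Sum>z\<in>set ys. q x z * q z x')) xs xs"
    unfolding list_mat_mult[OF assms(1)] by (intro eq_matI) (auto simp: list_mat_def)
  finally show ?thesis .
qed


subsection \<open>The characteristic polynomial of the signless Laplacian\<close>

lemma out_degree_eq_card_Image: "out_degree (with_proj X) x = card (parcs X `` {x})"
proof -
  have "out_arcs (with_proj X) x = Pair x ` (parcs X `` {x})"
    by (auto simp: out_arcs_def)
  then show ?thesis by (simp add: out_degree_def card_image inj_on_def)
qed

text \<open>The entries of x I - Q(X), with polynomials as scalars so that determinants live in an
  integral domain. Absence of loops leaves only the degree on the diagonal.\<close>

definition Q_char_entry :: "'a pair_pre_digraph \<Rightarrow> 'a \<Rightarrow> 'a \<Rightarrow> complex poly" where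
  "Q_char_entry X x y =
     (if x = y then [:- of_nat (card (parcs X `` {x})), 1:] else if (x, y) \<in> parcs X then - 1 else 0)"

definition Q_char_poly :: "'a pair_pre_digraph \<Rightarrow> complex poly" where
  "Q_char_poly X = char_poly (map_mat complex_of_real (signless_laplacian X (vertex_list X)))"

lemma Q_char_poly_eq_det:
  assumes X: "pair_graph X" and xs: "distinct xs" "set xs = pverts X"
  shows "Q_char_poly X = det (list_mat (Q_char_entry X) xs xs)"
proof -
  interpret pair_graph X by fact
  have "Q_char_poly X = char_poly (map_mat complex_of_real (signless_laplacian X xs))"
    unfolding Q_char_poly_def
    using char_poly_signless_laplacian_enum vertex_list[OF pair_finite_verts] xs by blast
  moreover have "char_poly_matrix (map_mat complex_of_real (signless_laplacian X xs)) =
      list_mat (Q_char_entry X) xs xs"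
    using xs
    by (intro eq_matI)
      (auto dest: no_loops simp: list_mat_def char_poly_matrix_def signless_laplacian_def degree_matrix_def
        adjacency_matrix_def Q_char_entry_def out_degree_eq_card_Image nth_eq_iff_index_eq one_pCons)
  ultimately show ?thesis by (simp add: char_poly_def)
qed

lemma monic_Q_char_poly: "lead_coeff (Q_char_poly X) = 1"
  unfolding Q_char_poly_def
  using degree_monic_char_poly[of "map_mat complex_of_real (signless_laplacian X (vertex_list X))"
      "length (vertex_list X)"]
  by (auto simp: signless_laplacian_def degree_matrix_def adjacency_matrix_def)

text \<open>A monic complex polynomial is the product of the linear factors of its roots, so the
  spectrum determines the characteristic polynomial.\<close>

lemma Q_cospectral_iff: "Q_cospectral X Y \<longleftrightarrow> Q_char_poly X = Q_char_poly Y"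
proof -
  have "Q_char_poly Z = (\<Prod>x\<in>#Q_spectrum Z. [:-x, 1:])" for Z :: "'c pair_pre_digraph"
    using complex_poly_decompose_multiset[of "Q_char_poly Z"]
    by (simp add: monic_Q_char_poly Q_spectrum_def flip: Q_char_poly_def)
  then show ?thesis
    unfolding Q_cospectral_def by (metis Q_spectrum_def Q_char_poly_def)
qed


subsection \<open>Elimination of the pockets\<close>

locale pocket =
  fixes H :: "'b pair_pre_digraph" and w :: 'b and m r :: nat
  assumes graph: "pair_graph H"
    and w: "w \<in> pverts H"
    and card_verts: "card (pverts H) = m"
    and degree_w: "out_degree (with_proj H) w = m - 1"
    and regular_del_w: "regular r (pre_digraph.del_vert (with_proj H) w)"
begin

interpretation H: pair_graph H by (rule graph)

lemma sym_parcs: "(x, y) \<in> parcs H \<longleftrightarrow> (y, x) \<in> parcs H"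
  using H.pair_sym_arcs by (auto simp: symmetric_def dest: symD)

lemma Image_subset: "parcs H `` {y} \<subseteq> pverts H - {y}"
  using H.in_arcsD2 by (auto dest: H.no_loops)

text \<open>The m - 1 neighbours of \<open>w\<close> lie among the m - 1 other vertices, so they
  exhaust them.\<close>

lemma Image_w: "parcs H `` {w} = pverts H - {w}"
  by (rule card_subset_eq)
    (use Image_subset[of w] H.pair_finite_verts degree_w w card_verts in
      \<open>simp_all add: out_degree_eq_card_Image\<close>)

lemma card_Image_diff:
  assumes "y \<in> pverts H - {w}"
  shows "card (parcs H `` {y} - {w}) = r"
proof -
  have "out_arcs (pre_digraph.del_vert (with_proj H) w) y = Pair y ` (parcs H `` {y} - {w})"
    using assms by (auto simp: out_arcs_def pre_digraph.del_vert_def)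
  then have "out_degree (pre_digraph.del_vert (with_proj H) w) y = card (parcs H `` {y} - {w})"
    by (simp add: out_degree_def card_image inj_on_def)
  then show ?thesis
    using regular_del_w assms by (auto simp: regular_def pre_digraph.del_vert_def)
qed

lemma card_Image:
  assumes "y \<in> pverts H - {w}"
  shows "card (parcs H `` {y}) = Suc r"
proof -
  have "w \<in> parcs H `` {y}" using assms Image_w sym_parcs by auto
  moreover have "finite (parcs H `` {y})"
    using Image_subset H.pair_finite_verts finite_subset by blast
  ultimately show ?thesis using card_Image_diff[OF assms] by (metis card_Suc_Diff1)
qed

text \<open>Entries of x I - B. The diagonal uses the degree r + 1 in H, which counts the edge to
  \<open>w\<close>, not the degree r in H - w.\<close>

definition B_char :: "'b \<Rightarrow> 'b \<Rightarrow> complex poly" where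
  "B_char y z = (if y = z then [:- of_nat (Suc r), 1:] else if (y, z) \<in> parcs H then - 1 else 0)"

abbreviation s :: "complex poly" where "s \<equiv> [:- of_nat (2 * r + 1), 1:]"

text \<open>A row of x I - B has x - (r + 1) on the diagonal and r entries -1, so it sums to x - (2
  r + 1). Hence the all-ones vector is an eigenvector with eigenvalue \<open>s\<close>.\<close>

lemma sum_B_char:
  assumes y: "y \<in> pverts H - {w}"
  shows "(\<Sum>z\<in>pverts H - {w}. B_char y z) = s"
proof -
  have fin: "finite (pverts H - {w})" using H.pair_finite_verts by simp
  let ?N = "parcs H `` {y} - {w}"
  have "(\<Sum>z\<in>pverts H - {w}. B_char y z) =
      (\<Sum>z\<in>pverts H - {w}. (if z = y then [:- of_nat (Suc r), 1:] else 0) +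
        (if z \<in> ?N then - 1 else 0))"
    \<comment> \<open>Absence of loops keeps \<open>y\<close> out of \<open>?N\<close>, so the two
      summands are never both nonzero.\<close>
    using Image_subset[of y] by (intro sum.cong) (auto simp: B_char_def)
  also have "\<dots> = [:- of_nat (Suc r), 1:] + (\<Sum>z\<in>pverts H - {w}. if z \<in> ?N then - 1 else 0)"
    unfolding sum.distrib using y fin by simp
  also have "(\<Sum>z\<in>pverts H - {w}. if z \<in> ?N then - 1 else 0 :: complex poly) =
      - of_nat (card ((pverts H - {w}) \<inter> ?N))"
    unfolding sum.inter_restrict[OF fin, symmetric] by simp
  also have "(pverts H - {w}) \<inter> ?N = ?N"
    using Image_subset[of y] by auto
  finally show ?thesis using card_Image_diff[OF y] by (simp add: of_nat_poly)
qed

definition B_list :: "'b list" where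
  "B_list = (SOME ys. distinct ys \<and> set ys = pverts H - {w})"

lemma B_list: "distinct B_list" "set B_list = pverts H - {w}"
proof -
  have "\<exists>ys. distinct ys \<and> set ys = pverts H - {w}"
    using finite_distinct_list[of "pverts H - {w}"] H.pair_finite_verts by blast
  then have "distinct B_list \<and> set B_list = pverts H - {w}"
    unfolding B_list_def by (rule someI_ex)
  then show "distinct B_list" "set B_list = pverts H - {w}" by auto
qed

definition B_det :: "complex poly" where
  "B_det = det (list_mat B_char B_list B_list)"

text \<open>Elimination of H - w with \<open>w\<close> as the only remaining vertex: the column of
  \<open>w\<close> is constantly -1 on H - w, hence an eigenvector. The factor before
  \<open>B_det\<close> involves only m and r, so it can later be cancelled to recover
  \<open>B_det\<close>.\<close>

lemma Q_char_poly_eq: "s * Q_char_poly H = (s * [:- of_nat (m - 1), 1:] - of_nat (m - 1)) * B_det"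
proof -
  let ?q = "Q_char_entry H"
  have qB: "?q y z = B_char y z" if "y \<in> pverts H - {w}" "z \<in> pverts H - {w}" for y z
    using card_Image[OF that(1)] by (auto simp: Q_char_entry_def B_char_def)
  have q1: "?q w z = - 1" "?q z w = - 1" if "z \<in> pverts H - {w}" for z
    using that Image_w sym_parcs by (auto simp: Q_char_entry_def)
  have "(\<Sum>z\<in>pverts H - {w}. ?q w z * ?q z w) = (\<Sum>z\<in>pverts H - {w}. 1)"
    by (intro sum.cong refl) (simp only: q1 minus_mult_minus mult_1)
  then have sum_w: "(\<Sum>z\<in>pverts H - {w}. ?q w z * ?q z w) = of_nat (m - 1)"
    using w card_verts by simp
  have "s ^ length [w] * det (list_mat ?q ([w] @ B_list) ([w] @ B_list)) =
    det (list_mat (\<lambda>x x'. s * ?q x x' - (\<Sum>z\<in>set B_list. ?q x z * ?q z x')) [w] [w]) *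
    det (list_mat ?q B_list B_list)"
  proof (rule det_list_mat_append_eigen[OF B_list(1)])
    fix x y assume "x \<in> set [w]" "y \<in> set B_list"
    then have x: "x = w" and y: "y \<in> pverts H - {w}" by (auto simp: B_list)
    have "(\<Sum>z\<in>set B_list. ?q y z * ?q z x) = (\<Sum>z\<in>pverts H - {w}. - B_char y z)"
      unfolding B_list x by (intro sum.cong refl) (simp only: qB[OF y] q1 mult_minus_right mult_1_right)
    also have "\<dots> = s * ?q y x"
      unfolding x by (simp only: sum_negf sum_B_char[OF y] q1[OF y] mult_minus_right mult_1_right)
    finally show "(\<Sum>z\<in>set B_list. ?q y z * ?q z x) = s * ?q y x" .
  qed
  also have "list_mat ?q B_list B_list = list_mat B_char B_list B_list"
    by (rule list_mat_cong) (auto simp: B_list qB)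
  also have "det (list_mat (\<lambda>x x'. s * ?q x x' - (\<Sum>z\<in>set B_list. ?q x z * ?q z x')) [w] [w]) =
      s * [:- of_nat (m - 1), 1:] - of_nat (m - 1)"
    using degree_w
    by (simp only: det_list_mat_single B_list sum_w) (simp add: Q_char_entry_def out_degree_eq_card_Image)
  also have "det (list_mat ?q ([w] @ B_list) ([w] @ B_list)) = Q_char_poly H"
    by (rule Q_char_poly_eq_det[symmetric]) (use graph B_list w in auto)
  finally show ?thesis by (simp add: B_det_def)
qed

end

section \<open>The pocket graph: adjacency, degrees and characteristic polynomial\<close>

locale pocketed = pocket H w m r
  for H :: "'b pair_pre_digraph" and w m r +
  fixes F :: "'a pair_pre_digraph" and V :: "'a set"
  assumes F: "pair_graph F" and V: "V \<subseteq> pverts F"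
begin

interpretation H: pair_graph H by (rule graph)
interpretation F: pair_graph F by (rule F)

abbreviation "G \<equiv> pocket_graph F V H w"

lemma parcs_pocket_graph:
  "(Inl a, Inl b) \<in> parcs G \<longleftrightarrow> (a, b) \<in> parcs F"
  "(Inl a, Inr (v, y)) \<in> parcs G \<longleftrightarrow> a = v \<and> v \<in> V \<and> y \<in> pverts H - {w}"
  "(Inr (v, y), Inl a) \<in> parcs G \<longleftrightarrow> a = v \<and> v \<in> V \<and> y \<in> pverts H - {w}"
  "(Inr (v, y), Inr (v', y')) \<in> parcs G \<longleftrightarrow>
    v = v' \<and> v \<in> V \<and> y \<noteq> w \<and> y' \<noteq> w \<and> (y, y') \<in> parcs H"
proof -
  have wz: "(w, z) \<in> parcs H \<longleftrightarrow> z \<in> pverts H - {w}"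
    and zw: "(z, w) \<in> parcs H \<longleftrightarrow> z \<in> pverts H - {w}" for z
    using Image_w sym_parcs by auto
  have arc: "(p, q) \<in> parcs G \<longleftrightarrow> (\<exists>x y. (x, y) \<in> parcs F \<and> p = Inl x \<and> q = Inl y) \<or>
      (\<exists>v x y. v \<in> V \<and> (x, y) \<in> parcs H \<and>
        p = (if x = w then Inl v else Inr (v, x)) \<and> q = (if y = w then Inl v else Inr (v, y)))" for p q
    by (force simp: pocket_graph_def simp del: pocket_glue_simps(2) simp flip: pocket_glue_simps(2))
  \<comment> \<open>A pocket arc with both ends glued into F would come from a loop at
    \<open>w\<close>, which \<open>wz\<close> rules out.\<close>
  show "(Inl a, Inl b) \<in> parcs G \<longleftrightarrow> (a, b) \<in> parcs F"
    unfolding arc using wz by (auto split: if_splits)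
  show "(Inl a, Inr (v, y)) \<in> parcs G \<longleftrightarrow> a = v \<and> v \<in> V \<and> y \<in> pverts H - {w}"
    unfolding arc using wz by (auto split: if_splits)
  show "(Inr (v, y), Inl a) \<in> parcs G \<longleftrightarrow> a = v \<and> v \<in> V \<and> y \<in> pverts H - {w}"
    unfolding arc using zw by (auto split: if_splits)
  show "(Inr (v, y), Inr (v', y')) \<in> parcs G \<longleftrightarrow>
      v = v' \<and> v \<in> V \<and> y \<noteq> w \<and> y' \<noteq> w \<and> (y, y') \<in> parcs H"
    unfolding arc by (auto split: if_splits)
qed

lemma pverts_pocket_graph:
  "Inl a \<in> pverts G \<longleftrightarrow> a \<in> pverts F"
  "Inr (v, y) \<in> pverts G \<longleftrightarrow> v \<in> V \<and> y \<in> pverts H - {w}"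
proof -
  have vert: "z \<in> pverts G \<longleftrightarrow> (\<exists>x\<in>pverts F. z = Inl x) \<or>
      (\<exists>v\<in>V. \<exists>y\<in>pverts H. z = (if y = w then Inl v else Inr (v, y)))" for z
    by (simp add: pocket_graph_def image_Un image_image Bex_def image_iff)
  show "Inl a \<in> pverts G \<longleftrightarrow> a \<in> pverts F"
    unfolding vert using V by (auto split: if_splits)
  show "Inr (v, y) \<in> pverts G \<longleftrightarrow> v \<in> V \<and> y \<in> pverts H - {w}"
    unfolding vert by (auto split: if_splits)
qed

text \<open>A root gains all of H - w as new neighbours because \<open>w\<close> is adjacent to all
  of it.\<close>

lemma card_Image_Inl:
  "card (parcs G `` {Inl a}) = card (parcs F `` {a}) + (if a \<in> V then m - 1 else 0)"
proof -
  have "parcs G `` {Inl a} =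
      Inl ` (parcs F `` {a}) \<union> (\<lambda>y. Inr (a, y)) ` (if a \<in> V then pverts H - {w} else {})"
  proof (rule Set.set_eqI)
    fix z show "z \<in> parcs G `` {Inl a} \<longleftrightarrow> z \<in> Inl ` (parcs F `` {a}) \<union>
        (\<lambda>y. Inr (a, y)) ` (if a \<in> V then pverts H - {w} else {})"
      by (cases z) (auto simp: parcs_pocket_graph)
  qed
  moreover have "finite (parcs F `` {a})"
    using F.in_arcsD2 by (intro finite_subset[OF _ F.pair_finite_verts]) auto
  moreover have "finite (if a \<in> V then pverts H - {w} else {})" using H.pair_finite_verts by simp
  ultimately have "card (parcs G `` {Inl a}) =
      card (Inl ` (parcs F `` {a}) :: ('a + 'a \<times> 'b) set) +
      card ((\<lambda>y. Inr (a, y)) ` (if a \<in> V then pverts H - {w} else {}) :: ('a + 'a \<times> 'b) set)"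
    by (simp only:) (rule card_Un_disjoint, auto)
  then show ?thesis using w card_verts by (simp add: card_image inj_on_def)
qed

text \<open>Gluing is injective within one copy of H, so vertices off the root keep their degree
  from H.\<close>

lemma card_Image_Inr:
  assumes "v \<in> V" "y \<in> pverts H - {w}"
  shows "card (parcs G `` {Inr (v, y)}) = Suc r"
proof -
  have "parcs G `` {Inr (v, y)} = (\<lambda>z. pocket_glue w (Inr (v, z))) ` (parcs H `` {y})"
  proof (rule Set.set_eqI)
    fix z
    have "(y, w) \<in> parcs H" using assms Image_w sym_parcs by auto
    then show "z \<in> parcs G `` {Inr (v, y)} \<longleftrightarrow>
        z \<in> (\<lambda>z. pocket_glue w (Inr (v, z))) ` (parcs H `` {y})"
      using assms by (cases z) (auto simp: parcs_pocket_graph image_iff)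
  qed
  moreover have "inj_on (\<lambda>z. pocket_glue w (Inr (v, z))) (parcs H `` {y})"
    by (auto simp: inj_on_def split: if_splits)
  ultimately show ?thesis using card_Image[OF assms(2)] by (simp only: card_image)
qed

lemma Q_char_entry_pocket_graph:
  "Q_char_entry G (Inl a) (Inl b) =
    (if a = b then [:- of_nat (card (parcs F `` {a}) + (if a \<in> V then m - 1 else 0)), 1:]
     else if (a, b) \<in> parcs F then - 1 else 0)"
  "y \<in> pverts H - {w} \<Longrightarrow> v \<in> V \<Longrightarrow>
    Q_char_entry G (Inl a) (Inr (v, y)) = (if a = v then - 1 else 0)"
  "y \<in> pverts H - {w} \<Longrightarrow> v \<in> V \<Longrightarrow>
    Q_char_entry G (Inr (v, y)) (Inl a) = (if a = v then - 1 else 0)"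
  "y \<in> pverts H - {w} \<Longrightarrow> y' \<in> pverts H - {w} \<Longrightarrow> v \<in> V \<Longrightarrow>
    Q_char_entry G (Inr (v, y)) (Inr (v', y')) = (if v = v' then B_char y y' else 0)"
  by (auto simp: Q_char_entry_def parcs_pocket_graph card_Image_Inl card_Image_Inr B_char_def)

text \<open>All pockets are eliminated at once, each contributing a factor \<open>B_det\<close> and
  a correction m - 1 at its root. Thus H enters the right-hand side only through m, r and
  \<open>B_det\<close>.\<close>

lemma Q_char_poly_pocket_graph:
  "s ^ card (pverts F) * Q_char_poly G =
    det (list_mat (\<lambda>a b. s *
        (if a = b then [:- of_nat (card (parcs F `` {a}) + (if a \<in> V then m - 1 else 0)), 1:]
         else if (a, b) \<in> parcs F then - 1 else 0) -
        (if a = b \<and> a \<in> V then of_nat (m - 1) else 0)) (vertex_list F) (vertex_list F)) *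
    B_det ^ card V"
proof -
  let ?q = "Q_char_entry G"
  note fs = vertex_list[OF F.pair_finite_verts]
  have fin: "finite V" "finite (pverts H - {w})"
    using finite_subset[OF V F.pair_finite_verts] H.pair_finite_verts by auto
  obtain vs where vs: "distinct vs" "set vs = V" using finite_distinct_list[OF fin(1)] by blast
  define xs :: "('a + 'a \<times> 'b) list" where "xs = map Inl (vertex_list F)"
  define row :: "'a \<Rightarrow> ('a + 'a \<times> 'b) list" where "row v = map (\<lambda>y. Inr (v, y)) B_list" for v
  define ys where "ys = concat (map row vs)"
  have set_ys: "set ys = (\<lambda>(v, y). Inr (v, y)) ` (V \<times> (pverts H - {w}))"
    using vs B_list by (auto simp: ys_def row_def)
  have "ys = map Inr (List.product vs B_list)"
    by (simp add: ys_def row_def[abs_def] product_concat_map map_concat comp_def)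
  then have dist_ys: "distinct ys"
    using vs B_list by (simp add: distinct_map distinct_product)
  have sum_ys: "(\<Sum>z\<in>set ys. g z) = (\<Sum>v\<in>V. \<Sum>y\<in>pverts H - {w}. g (Inr (v, y)))"
    for g :: "_ \<Rightarrow> complex poly"
    unfolding set_ys by (subst sum.reindex) (auto simp: inj_on_def sum.cartesian_product case_prod_unfold)
  have "Q_char_poly G = det (list_mat ?q (xs @ ys) (xs @ ys))"
  proof (rule Q_char_poly_eq_det)
    show "pair_graph G" by (rule pair_graph_pocket_graph[OF F graph V])
    show "distinct (xs @ ys)" using dist_ys fs set_ys by (auto simp: xs_def distinct_map)
    show "set (xs @ ys) = pverts G"
    proof (rule Set.set_eqI)
      fix z show "z \<in> set (xs @ ys) \<longleftrightarrow> z \<in> pverts G"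
        unfolding set_append set_ys
        by (cases z) (auto simp: xs_def fs pverts_pocket_graph image_iff)
    qed
  qed
  moreover have "s ^ length xs * det (list_mat ?q (xs @ ys) (xs @ ys)) =
      det (list_mat (\<lambda>x x'. s * ?q x x' - (\<Sum>z\<in>set ys. ?q x z * ?q z x')) xs xs) *
      det (list_mat ?q ys ys)"
  proof (rule det_list_mat_append_eigen[OF dist_ys])
    fix x y assume "x \<in> set xs" "y \<in> set ys"
    then obtain a v z where x: "x = Inl a" and y: "y = Inr (v, z)" and vz: "v \<in> V" "z \<in> pverts H - {w}"
      by (auto simp: xs_def set_ys)
    \<comment> \<open>The column of \<open>Inl a\<close> is -1 on the pocket at \<open>a\<close> and
      0 on every other pocket, while the row of (v, z) vanishes outside the pocket at
      \<open>v\<close>. So the row sum \<open>s\<close> of one pocket is the eigenvalue.\<close>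
    have "(\<Sum>t\<in>set ys. ?q y t * ?q t x) =
        (\<Sum>v'\<in>V. if v' = v then (\<Sum>y'\<in>pverts H - {w}. B_char z y') * (if a = v then - 1 else 0) else 0)"
      unfolding sum_ys x y
      by (intro sum.cong) (use vz in \<open>auto simp: Q_char_entry_pocket_graph sum_negf\<close>)
    also have "\<dots> = s * (if a = v then - 1 else 0)"
      using fin vz sum_B_char by simp
    finally show "(\<Sum>t\<in>set ys. ?q y t * ?q t x) = s * ?q y x"
      using vz by (simp add: x y Q_char_entry_pocket_graph)
  qed
  moreover have "det (list_mat ?q ys ys) = B_det ^ card V"
  proof -
    have "det (list_mat ?q ys ys) = (\<Prod>v\<leftarrow>vs. det (list_mat ?q (row v) (row v)))"
      unfolding ys_def
    proof (rule det_list_mat_concat[OF vs(1)])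
      fix v v' x y assume "v \<in> set vs" "v' \<in> set vs" "v \<noteq> v'" "x \<in> set (row v)" "y \<in> set (row v')"
      then show "?q x y = 0" by (auto simp: row_def B_list vs Q_char_entry_pocket_graph)
    qed
    also have "map (\<lambda>v. det (list_mat ?q (row v) (row v))) vs = map (\<lambda>v. B_det) vs"
    proof (rule map_cong[OF refl])
      fix v assume "v \<in> set vs"
      then have "list_mat ?q (row v) (row v) = list_mat B_char B_list B_list"
        unfolding row_def list_mat_map
        by (intro list_mat_cong) (simp add: vs B_list Q_char_entry_pocket_graph)
      then show "det (list_mat ?q (row v) (row v)) = B_det" by (simp add: B_det_def)
    qed
    also have "prod_list \<dots> = B_det ^ card V"
      using vs distinct_card[of vs] by (simp add: map_replicate_const prod_list_replicate)
    finally show ?thesis .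
  qed
  moreover have "list_mat (\<lambda>x x'. s * ?q x x' - (\<Sum>z\<in>set ys. ?q x z * ?q z x')) xs xs =
      list_mat (\<lambda>a b. s *
        (if a = b then [:- of_nat (card (parcs F `` {a}) + (if a \<in> V then m - 1 else 0)), 1:]
         else if (a, b) \<in> parcs F then - 1 else 0) -
        (if a = b \<and> a \<in> V then of_nat (m - 1) else 0)) (vertex_list F) (vertex_list F)"
    unfolding xs_def list_mat_map
  proof (rule list_mat_cong)
    fix a b :: 'a
    \<comment> \<open>A pocket vertex contributes only if its root is both \<open>a\<close> and
      \<open>b\<close>; then each of the m - 1 vertices gives (-1)(-1) = 1.\<close>
    have "(\<Sum>z\<in>set ys. ?q (Inl a) z * ?q z (Inl b)) =
        (\<Sum>v\<in>V. if v = a then if a = b then of_nat (m - 1) else 0 else 0)"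
      unfolding sum_ys
      by (intro sum.cong) (use w card_verts in \<open>auto simp: Q_char_entry_pocket_graph\<close>)
    then show "s * ?q (Inl a) (Inl b) - (\<Sum>z\<in>set ys. ?q (Inl a) z * ?q z (Inl b)) =
        s * (if a = b then [:- of_nat (card (parcs F `` {a}) + (if a \<in> V then m - 1 else 0)), 1:]
         else if (a, b) \<in> parcs F then - 1 else 0) -
        (if a = b \<and> a \<in> V then of_nat (m - 1) else 0)"
      using fin by (simp add: Q_char_entry_pocket_graph(1))
  qed
  moreover have "length xs = card (pverts F)"
    using fs distinct_card[of "vertex_list F"] by (simp add: xs_def)
  ultimately show ?thesis by simp
qed

end

section \<open>Comparison of the two pocket graphs by cancellation\<close>

theorem corollary3p7:
  fixes F :: "'a pair_pre_digraph" and Vk :: "'a set"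
    and Hu Hv :: "'b pair_pre_digraph" and u v :: 'b
    and n k m r1 :: nat
  assumes "pair_graph F" and "card (pverts F) = n" and "n \<ge> 1"
    and "Vk \<subseteq> pverts F" and "card Vk = k"
    and "pair_graph Hu" and "pair_graph Hv"
    and "pverts Hu \<inter> pverts Hv = {}"
    and "card (pverts Hu) = m" and "card (pverts Hv) = m"
    and "u \<in> pverts Hu" and "v \<in> pverts Hv"
    and "out_degree (with_proj Hu) u = m - 1" and "out_degree (with_proj Hv) v = m - 1"
    and "regular r1 (pre_digraph.del_vert (with_proj Hu) u)"
    and "regular r1 (pre_digraph.del_vert (with_proj Hv) v)"
    and "m \<ge> 2" and "r1 \<ge> 1"
    and "Q_cospectral Hu Hv"
  shows "Q_cospectral (pocket_graph F Vk Hu u) (pocket_graph F Vk Hv v)"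
proof -
  interpret U: pocketed Hu u m r1 F Vk by (intro pocketed.intro pocket.intro pocketed_axioms.intro) fact+
  interpret V: pocketed Hv v m r1 F Vk by (intro pocketed.intro pocket.intro pocketed_axioms.intro) fact+
  let ?s = "[:- of_nat (2 * r1 + 1), 1:] :: complex poly"
  let ?p = "?s * [:- of_nat (m - 1), 1:] - of_nat (m - 1)"
  have "Q_char_poly Hu = Q_char_poly Hv" using assms Q_cospectral_iff by blast
  then have "?p * U.B_det = ?p * V.B_det" using U.Q_char_poly_eq V.Q_char_poly_eq by metis
  \<comment> \<open>\<open>?p\<close> is a product of two monic linear polynomials minus a constant,
    so it is monic of degree 2 and may be cancelled.\<close>
  moreover have "coeff ?p 2 = 1" by (simp add: of_nat_poly numeral_2_eq_2)
  then have "?p \<noteq> 0" by (metis coeff_0 zero_neq_one)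
  ultimately have "U.B_det = V.B_det" using mult_left_cancel by blast
  then have "?s ^ card (pverts F) * Q_char_poly (pocket_graph F Vk Hu u) =
      ?s ^ card (pverts F) * Q_char_poly (pocket_graph F Vk Hv v)"
    unfolding U.Q_char_poly_pocket_graph V.Q_char_poly_pocket_graph by simp
  \<comment> \<open>The power of \<open>?s\<close> is nonzero and cancels in the integral domain of
    polynomials.\<close>
  then show ?thesis unfolding Q_cospectral_iff by simp
qed

end
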